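(* Let $n\ge 1$, let $P\in\mathscr{P}_n$ be a polynomial which does not vanish in $|z|<1$, let $B\in\mathcal{B}_n$ have parameters $\lambda_0,\lambda_1,\lambda_2$, and put $m=\min_{|z|=1}|P(z)|$. Then for every $\alpha\in\mathbb{C}$ with $|\alpha|\le 1$ and every $R>1$, with $\sigma(z)=Rz$, $$\left\|B[P\circ\sigma](z)-\alpha B[P](z)\right\|_\infty\le\frac{|R^n-\alpha||\Lambda_n|+|(1-\alpha)\lambda_0|}{2}\,\|P(z)\|_\infty-\frac{|R^n-\alpha||\Lambda_n|-|(1-\alpha)\lambda_0|}{2}\,m .$$
   Context: $\mathscr{P}_n$ is the space of complex polynomials of degree at most $n$. For a polynomial $Q$, $\|Q(z)\|_\infty:=\max_{|z|=1}|Q(z)|$. $P\circ\sigma$ denotes the composite $(P\circ\sigma)(z)=P(\sigma(z))$. The class $\mathcal{B}_n$ consists of the operators $B$ carrying $P\in\mathscr{P}_n$ into $$B[P](z):=\lambda_0P(z)+\lambda_1\left(\frac{nz}{2}\right)\frac{P'(z)}{1!}+\lambda_2\left(\frac{nz}{2}\right)^2\frac{P''(z)}{2!},$$ where $\lambda_0,\lambda_1,\lambda_2\in\mathbb{C}$ are such that all the zeros of $U(z):=\lambda_0+\lambda_1\binom n1 z+\lambda_2\binom n2 z^2$ lie in the half plane $|z|\le|z-n/2|$. Also $\Lambda_n:=\lambda_0+\lambda_1\frac{n^2}{2}+\lambda_2\frac{n^3(n-1)}{8}$. *)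

theory Defs
  imports "HOL-Analysis.Analysis" "HOL-Computational_Algebra.Polynomial"
begin

definition max_mod :: "complex poly \<Rightarrow> real" where
  "max_mod Q = (SUP z\<in>sphere 0 1. cmod (poly Q z))"

definition min_mod :: "complex poly \<Rightarrow> real" where
  "min_mod Q = (INF z\<in>sphere 0 1. cmod (poly Q z))"

text \<open>The supremum and the infimum are attained, i.e. they are a maximum and a minimum.\<close>

lemma max_mod_attained:
  "\<exists>z\<in>sphere 0 1. max_mod Q = cmod (poly Q z) \<and> (\<forall>w\<in>sphere 0 1. cmod (poly Q w) \<le> cmod (poly Q z))"
proof -
  have "continuous_on (sphere 0 1) (\<lambda>z. cmod (poly Q z))"
    by (intro continuous_intros)
  then obtain z where z: "z \<in> sphere 0 1"
    "\<forall>w\<in>sphere 0 1. cmod (poly Q w) \<le> cmod (poly Q z)"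
    using continuous_attains_sup[of "sphere (0::complex) 1"] by fastforce
  then have "max_mod Q = cmod (poly Q z)"
    unfolding max_mod_def by (intro cSup_eq_maximum) auto
  with z show ?thesis by blast
qed

lemma min_mod_attained:
  "\<exists>z\<in>sphere 0 1. min_mod Q = cmod (poly Q z) \<and> (\<forall>w\<in>sphere 0 1. cmod (poly Q z) \<le> cmod (poly Q w))"
proof -
  have "continuous_on (sphere 0 1) (\<lambda>z. cmod (poly Q z))"
    by (intro continuous_intros)
  then obtain z where z: "z \<in> sphere 0 1"
    "\<forall>w\<in>sphere 0 1. cmod (poly Q z) \<le> cmod (poly Q w)"
    using continuous_attains_inf[of "sphere (0::complex) 1"] by fastforce
  then have "min_mod Q = cmod (poly Q z)"
    unfolding min_mod_def by (intro cInf_eq_minimum) auto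
  with z show ?thesis by blast
qed

definition U_poly :: "nat \<Rightarrow> complex \<Rightarrow> complex \<Rightarrow> complex \<Rightarrow> complex poly" where
  "U_poly n l0 l1 l2 = [:l0, l1 * of_nat (n choose 1), l2 * of_nat (n choose 2):]"

text \<open>If \<open>U_poly n l0 l1 l2\<close> is a nonzero constant, the condition below holds vacuously;
  if it is the zero polynomial and \<open>n \<ge> 1\<close>, the condition fails.\<close>

definition admissible :: "nat \<Rightarrow> complex \<Rightarrow> complex \<Rightarrow> complex \<Rightarrow> bool" where
  "admissible n l0 l1 l2 \<longleftrightarrow>
     (\<forall>z. poly (U_poly n l0 l1 l2) z = 0 \<longrightarrow> cmod z \<le> cmod (z - of_nat n / 2))"

definition B_op :: "nat \<Rightarrow> complex \<Rightarrow> complex \<Rightarrow> complex \<Rightarrow> complex poly \<Rightarrow> complex poly" where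
  "B_op n l0 l1 l2 P =
     smult l0 P
     + smult l1 ([:0, of_nat n / 2:] * smult (1 / fact 1) (pderiv P))
     + smult l2 ([:0, of_nat n / 2:] ^ 2 * smult (1 / fact 2) (pderiv (pderiv P)))"

lemma poly_B_op:
  "poly (B_op n l0 l1 l2 P) z =
     l0 * poly P z
     + l1 * (of_nat n * z / 2) * (poly (pderiv P) z / fact 1)
     + l2 * (of_nat n * z / 2) ^ 2 * (poly (pderiv (pderiv P)) z / fact 2)"
  by (simp add: B_op_def power2_eq_square mult_ac)

definition B_class :: "nat \<Rightarrow> complex \<Rightarrow> complex \<Rightarrow> complex \<Rightarrow> (complex poly \<Rightarrow> complex poly) \<Rightarrow> bool" where
  "B_class n l0 l1 l2 B \<longleftrightarrow>
     admissible n l0 l1 l2 \<and> (\<forall>P. degree P \<le> n \<longrightarrow> B P = B_op n l0 l1 l2 P)"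

definition Lam :: "nat \<Rightarrow> complex \<Rightarrow> complex \<Rightarrow> complex \<Rightarrow> complex" where
  "Lam n l0 l1 l2 =
     l0 + l1 * (of_nat n ^ 2 / 2) + l2 * (of_nat n ^ 3 * (of_nat n - 1) / 8)"

end

theory Submission
  imports Defs "HOL-Complex_Analysis.Conformal_Mappings"
    "HOL-Computational_Algebra.Fundamental_Theorem_Algebra"
begin

text \<open>
  Let \<open>T\<close> take \<open>p\<close> to \<open>B[p \<circ> \<sigma>] - \<alpha> B[p]\<close>. It is linear, maps \<open>1\<close> to the constant
  \<open>a = (1 - \<alpha>) \<lambda>\<^sub>0\<close> and \<open>z\<^sup>n\<close> to \<open>b z\<^sup>n\<close> with \<open>b = (R\<^sup>n - \<alpha>) \<Lambda>\<^sub>n\<close>. Let \<open>Q\<close> be the conjugate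
  reciprocal of \<open>P\<close>, with \<open>|Q| = |P|\<close> on the unit circle, and let \<open>M\<close> and \<open>m\<close> be the maximum and
  the minimum of \<open>|P|\<close> there.

  Everything rests on one fact about zeros (\<open>B_op_dilation_diff_nonzero\<close>): if \<open>F\<close> has degree \<open>n\<close> and
  all its zeros in the closed disc, then \<open>T F\<close> has no zero outside the open disc. The condition on
  \<open>U\<close> enters here: \<open>B[f](w) / f(w)\<close> is the polarization of \<open>U\<close> at \<open>n\<close> points of the half plane
  where \<open>U\<close> has no zeros, so it is nonzero by the quadratic case of Walsh's coincidence theorem
  (\<open>walsh_coincidence_quadratic\<close>). Applied to \<open>F + c f\<close> with \<open>|c| < 1\<close>, the fact gives a comparison
  principle (\<open>norm_B_op_dilation_diff_le\<close>): \<open>|f| \<le> |F|\<close> outside the disc implies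
  \<open>|T f| \<le> |T F|\<close> there.

  A polynomial \<open>h\<close> without zeros in the open disc is dominated outside it by its reciprocal. Take
  \<open>h = P + c\<close>, whose reciprocal is \<open>Q + cnj c * z\<^sup>n\<close>: it has no zeros in the open disc when
  \<open>|c| < m\<close> or \<open>c = 0\<close>, and also when \<open>|c| > M\<close>. Choosing the argument of \<open>c\<close> well, letting \<open>|c|\<close> tend to \<open>m\<close> or \<open>M\<close>, and
  using the comparisons \<open>m |b| \<le> |T Q| \<le> M |b|\<close> to determine signs, one finds on the circle
  \<open>|T P| - m |a| \<le> |T Q| - m |b|\<close> and \<open>|T P| - M |a| \<le> M |b| - |T Q|\<close>.
  Adding the two eliminates \<open>|T Q|\<close> and gives the theorem.
\<close>

section \<open>Walsh's coincidence theorem for quadratics\<close>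

text \<open>Read \<open>u\<close> and \<open>v\<close> as impedances: \<open>u v / (u + v)\<close> is their parallel sum, and reactances (imaginary
  parts) can only increase the resistance. After clearing denominators the gap is the square of
  \<open>Im u * Re v - Im v * Re u\<close>.\<close>

lemma Re_parallel_sum_ge:
  assumes "Re u > 0" "Re v > 0"
  shows "Re (u * v / (u + v)) \<ge> Re u * Re v / (Re u + Re v)"
proof -
  define p q s t where d: "p = Re u" "q = Re v" "s = Im u" "t = Im v"
  have pq: "p > 0" "q > 0" using assms by (auto simp: d)
  have D: "(p + q)^2 + (s + t)^2 > 0" using pq by (simp add: add_pos_nonneg)
  have "Re (u * v / (u + v)) = ((p^2 + s^2) * q + (q^2 + t^2) * p) / ((p + q)^2 + (s + t)^2)"
    by (simp add: d Re_divide power2_eq_square) (simp add: algebra_simps)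
  moreover have "p * q / (p + q) \<le> ((p^2 + s^2) * q + (q^2 + t^2) * p) / ((p + q)^2 + (s + t)^2)"
  proof -
    have "((p^2 + s^2) * q + (q^2 + t^2) * p) * (p + q) - p * q * ((p + q)^2 + (s + t)^2) = (s * q - t * p)^2"
      by (simp add: power2_eq_square algebra_simps)
    then have "p * q * ((p + q)^2 + (s + t)^2) \<le> ((p^2 + s^2) * q + (q^2 + t^2) * p) * (p + q)"
      using zero_le_power2[of "s * q - t * p"] by linarith
    then show ?thesis using D pq by (simp add: divide_simps)
  qed
  ultimately show ?thesis by (simp add: d)
qed

text \<open>Each summand \<open>u\<^sub>i (S - u\<^sub>i) / S\<close> is the parallel sum of \<open>u\<^sub>i\<close> and of the sum of the other
  entries. With \<open>N\<close> entries these have real parts above \<open>\<beta>\<close> and \<open>(N - 1) \<beta>\<close>, and real parallel sums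
  increase in both arguments, so each summand has real part above \<open>(N - 1) \<beta> / N\<close>.
  The sum of the products \<open>u\<^sub>i (S - u\<^sub>i)\<close> is twice the second elementary symmetric function.\<close>

lemma Re_pair_sum_quotient_gt:
  fixes u :: "'i \<Rightarrow> complex"
  assumes fin: "finite I" and two: "card I \<ge> 2" and b: "\<beta> \<ge> 0"
    and u: "\<And>i. i \<in> I \<Longrightarrow> Re (u i) > \<beta>"
  shows "Re ((\<Sum>i\<in>I. u i * (sum u I - u i)) / sum u I) > (real (card I) - 1) * \<beta>"
proof -
  define k where "k = real (card I) - 1"
  have k: "k > 0" using two by (simp add: k_def)
  have "I \<noteq> {}" using two by auto
  have each: "Re (u i * (sum u I - u i) / sum u I) > k * \<beta> / (k + 1)" if i: "i \<in> I" for i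
  proof -
    define p q where "p = Re (u i)" and "q = Re (sum u I - u i)"
    have card': "card (I - {i}) = card I - 1" using i fin by simp
    have rest: "sum u I - u i = sum u (I - {i})" using fin i by (simp add: sum_diff1)
    have "I - {i} \<noteq> {}" using card' two by (metis One_nat_def card.empty diff_is_0_eq not_less_eq_eq numeral_2_eq_2)
    then have "(\<Sum>j\<in>I - {i}. \<beta>) < (\<Sum>j\<in>I - {i}. Re (u j))"
      using fin u by (intro sum_strict_mono) auto
    then have q: "q > k * \<beta>"
      using two by (simp add: q_def rest k_def card' of_nat_diff)
    have p: "p > \<beta>" using u[OF i] by (simp add: p_def)
    have kb: "k * \<beta> \<ge> 0" using k b by simp
    have pos: "p > 0" "q > 0" using p q b kb by linarith+
    have "p * (q - k * \<beta>) + k * q * (p - \<beta>) > 0"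
      using pos p q k by (intro add_pos_pos mult_pos_pos) auto
    then have "k * \<beta> * (p + q) < p * q * (k + 1)" by (simp add: algebra_simps)
    then have "k * \<beta> / (k + 1) < p * q / (p + q)" using pos k by (simp add: divide_simps)
    also have "\<dots> \<le> Re (u i * (sum u I - u i) / sum u I)"
      using Re_parallel_sum_ge[of "u i" "sum u I - u i"] pos by (simp add: p_def q_def)
    finally show ?thesis .
  qed
  have "k * \<beta> = (\<Sum>i\<in>I. k * \<beta> / (k + 1))" using k by (simp add: k_def)
  also have "\<dots> < (\<Sum>i\<in>I. Re (u i * (sum u I - u i) / sum u I))"
    using fin \<open>I \<noteq> {}\<close> each by (intro sum_strict_mono) auto
  also have "\<dots> = Re ((\<Sum>i\<in>I. u i * (sum u I - u i)) / sum u I)"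
    by (simp add: sum_divide_distrib)
  finally show ?thesis by (simp add: k_def)
qed

lemma complex_quadratic_factor:
  fixes A B C :: complex
  assumes "A \<noteq> 0"
  obtains a b where "B = - A * (a + b)" "C = A * a * b"
proof -
  define s where "s = csqrt (B^2 - 4 * A * C)"
  have s: "s^2 = B^2 - 4 * A * C" by (simp add: s_def)
  show ?thesis
  proof
    show "B = - A * ((- B + s) / (2 * A) + (- B - s) / (2 * A))"
      using assms by (simp add: field_simps)
    have "A * ((- B + s) / (2 * A)) * ((- B - s) / (2 * A)) = (B^2 - s^2) / (4 * A)"
      using assms by (simp add: field_simps power2_eq_square)
    then show "C = A * ((- B + s) / (2 * A)) * ((- B - s) / (2 * A))"
      using assms by (simp add: s)
  qed
qed

text \<open>The quadratic case of Walsh's coincidence theorem for a half plane: polarizing \<open>U\<close> replaces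
  \<open>n z\<close> and \<open>(n choose 2) z\<^sup>2\<close> by the elementary symmetric functions of \<open>n\<close> points, and the
  polarized form does not vanish when all points lie where \<open>U\<close> has no zero.
  If \<open>U\<close> is quadratic, let \<open>a, b\<close> be its zeros and translate by \<open>u\<^sub>i = x\<^sub>i - b\<close>. The polarized
  form vanishes exactly when \<open>(n - 1) (a - b)\<close> is the quotient bounded in
  \<open>Re_pair_sum_quotient_gt\<close>, taken with \<open>\<beta> = c - Re b\<close>. That bound then says \<open>Re a > c\<close>, which is impossible.\<close>

lemma walsh_coincidence_quadratic:
  fixes x :: "'i \<Rightarrow> complex"
  assumes fin: "finite I" and card: "card I = n" and n: "n \<ge> 1"
    and x: "\<And>i. i \<in> I \<Longrightarrow> Re (x i) > c"
    and U: "\<And>z. Re z > c \<Longrightarrow> l0 + l1 * of_nat n * z + l2 * of_nat (n choose 2) * z^2 \<noteq> 0"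
  shows "l0 + l1 * sum x I + l2 * ((sum x I)^2 - (\<Sum>i\<in>I. x i ^ 2)) / 2 \<noteq> 0"
proof (cases "l2 * of_nat (n choose 2) = 0")
  case True
  have "I \<noteq> {}" using card n by auto
  have "(\<Sum>i\<in>I. c) < (\<Sum>i\<in>I. Re (x i))"
    using fin \<open>I \<noteq> {}\<close> x by (intro sum_strict_mono) auto
  then have mean: "Re (sum x I / of_nat n) > c"
    using n card by (simp add: divide_simps mult.commute)
  \<comment> \<open>The polarized form is affine here, so it takes the value of \<open>U\<close> at the mean of the points.\<close>
  have last: "l2 * ((sum x I)^2 - (\<Sum>i\<in>I. x i ^ 2)) = 0"
  proof (cases "l2 = 0")
    case False
    then have "n = 1" using True n by (auto simp: binomial_eq_0_iff)
    then obtain i where "I = {i}" using card card_1_singletonE by blast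
    then show ?thesis by simp
  qed auto
  have "l1 * of_nat n * (sum x I / of_nat n) = l1 * sum x I" using n by simp
  then show ?thesis using U[OF mean] True last n by auto
next
  case False
  define L where "L = l2 * of_nat (n choose 2)"
  have L: "L \<noteq> 0" using False by (simp add: L_def)
  have n2: "n \<ge> 2"
    using False n by (metis binomial_eq_0_iff mult_zero_right not_le of_nat_0)
  have ch: "of_nat (n choose 2) = (of_nat n * (of_nat n - 1) / 2 :: complex)"
  proof -
    have "2 * (n choose 2) = n * (n - 1)" using n2 by (simp add: choose_two even_two_times_div_two)
    then have "of_nat (2 * (n choose 2)) = (of_nat (n * (n - 1)) :: complex)" by (rule arg_cong)
    then show ?thesis using n by (simp add: of_nat_diff mult.commute)
  qed
  obtain a b where ab: "l1 * of_nat n = - L * (a + b)" "l0 = L * a * b"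
    using complex_quadratic_factor[OF L] by blast
  have fact: "l0 + l1 * of_nat n * z + l2 * of_nat (n choose 2) * z^2 = L * (z - a) * (z - b)" for z
    unfolding ab L_def[symmetric] by (simp add: algebra_simps power2_eq_square)
  have ac: "Re a \<le> c" and bc: "Re b \<le> c"
    using U[of a] U[of b] unfolding fact by force+
  define u where "u i = x i - b" for i
  have Re_u: "Re (u i) > c - Re b" if "i \<in> I" for i using x[OF that] by (simp add: u_def)
  have sx: "sum x I = sum u I + of_nat n * b"
    by (simp add: u_def sum_subtractf card)
  have sx2: "(\<Sum>i\<in>I. x i ^ 2) = (\<Sum>i\<in>I. u i ^ 2) + 2 * b * sum u I + of_nat n * b^2"
  proof -
    have "(\<Sum>i\<in>I. x i ^ 2) = (\<Sum>i\<in>I. u i ^ 2 + 2 * b * u i + b^2)"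
      by (simp add: u_def power2_eq_square algebra_simps)
    then show ?thesis by (simp add: sum.distrib sum_distrib_left card)
  qed
  define S where "S = sum u I"
  define S2 where "S2 = (\<Sum>i\<in>I. u i ^ 2)"
  have pairs: "(\<Sum>i\<in>I. u i * (sum u I - u i)) = S^2 - S2"
    by (simp add: S_def S2_def right_diff_distrib sum_subtractf power2_eq_square sum_distrib_right)
  have gt: "Re ((S^2 - S2) / S) > (real n - 1) * (c - Re b)"
    using Re_pair_sum_quotient_gt[OF fin, of "c - Re b" u] Re_u bc n2 card
    by (simp add: pairs[unfolded S_def] S_def)
  have "Re S > 0"
    using fin Re_u bc n2 card unfolding S_def Re_sum by (intro sum_pos) fastforce+
  then have S0: "S \<noteq> 0" by auto
  show ?thesis
  proof
    assume "l0 + l1 * sum x I + l2 * ((sum x I)^2 - (\<Sum>i\<in>I. x i ^ 2)) / 2 = 0"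
    then have "of_nat n * (of_nat n - 1) * (l0 + l1 * sum x I + l2 * ((sum x I)^2 - (\<Sum>i\<in>I. x i ^ 2)) / 2) = 0"
      by simp
    also have "of_nat n * (of_nat n - 1) * (l0 + l1 * sum x I + l2 * ((sum x I)^2 - (\<Sum>i\<in>I. x i ^ 2)) / 2)
      = of_nat n * (of_nat n - 1) * l0 + (of_nat n - 1) * (l1 * of_nat n) * sum x I
        + L * ((sum x I)^2 - (\<Sum>i\<in>I. x i ^ 2))"
      by (simp add: L_def ch field_simps)
    also have "\<dots> = L * (S^2 - S2 - (of_nat n - 1) * (a - b) * S)"
      unfolding sx sx2 ab S_def[symmetric] S2_def[symmetric]
      by (simp add: algebra_simps power2_eq_square)
    finally have "S^2 - S2 = (of_nat n - 1) * (a - b) * S" using L by simp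
    then have "(S^2 - S2) / S = (of_nat n - 1) * (a - b)" using S0 by simp
    then have "Re ((S^2 - S2) / S) = (real n - 1) * (Re a - Re b)" by simp
    also have "\<dots> \<le> (real n - 1) * (c - Re b)"
      using n ac by (intro mult_left_mono) auto
    finally show False using gt by simp
  qed
qed

section \<open>Zeros of \<open>B[f]\<close>\<close>

lemma pderiv_linear_mult:
  fixes p :: "complex poly"
  shows "pderiv ([:- a, 1:] * p) = p + [:- a, 1:] * pderiv p"
  by (simp add: pderiv_mult pderiv_pCons del: mult_pCons_left)

lemma poly_pderiv_prod_linear:
  fixes r :: "'i \<Rightarrow> complex"
  assumes "finite I" and "\<And>i. i \<in> I \<Longrightarrow> w \<noteq> r i"
  shows "poly (pderiv (\<Prod>i\<in>I. [:- r i, 1:])) w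
    = poly (\<Prod>i\<in>I. [:- r i, 1:]) w * (\<Sum>i\<in>I. 1 / (w - r i))"
  using assms
proof (induction I rule: finite_induct)
  case (insert j I)
  define p where "p = poly (\<Prod>i\<in>I. [:- r i, 1:]) w"
  have "poly (pderiv (\<Prod>i\<in>insert j I. [:- r i, 1:])) w = p + (w - r j) * (p * (\<Sum>i\<in>I. 1 / (w - r i)))"
    using insert by (simp add: pderiv_linear_mult p_def left_diff_distrib del: mult_pCons_left)
  also have "\<dots> = (w - r j) * p * (1 / (w - r j) + (\<Sum>i\<in>I. 1 / (w - r i)))"
    using insert.prems[of j] by (simp add: distrib_left)
  finally show ?case using insert by (simp add: p_def left_diff_distrib)
qed auto

text \<open>Twice the second elementary symmetric function of the numbers \<open>1 / (w - r\<^sub>i)\<close> appears here, written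
  through power sums so that it fits the polarized form above.\<close>

lemma poly_pderiv2_prod_linear:
  fixes r :: "'i \<Rightarrow> complex"
  assumes "finite I" and "\<And>i. i \<in> I \<Longrightarrow> w \<noteq> r i"
  shows "poly (pderiv (pderiv (\<Prod>i\<in>I. [:- r i, 1:]))) w
    = poly (\<Prod>i\<in>I. [:- r i, 1:]) w
      * ((\<Sum>i\<in>I. 1 / (w - r i))^2 - (\<Sum>i\<in>I. (1 / (w - r i))^2))"
  using assms
proof (induction I rule: finite_induct)
  case (insert j I)
  define v where "v = 1 / (w - r j)"
  have v: "(w - r j) * v = 1" using insert.prems by (simp add: v_def)
  define p where "p = poly (\<Prod>i\<in>I. [:- r i, 1:]) w"
  define S where "S = (\<Sum>i\<in>I. 1 / (w - r i))"
  define T where "T = (\<Sum>i\<in>I. (1 / (w - r i))^2)"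
  have d1: "poly (pderiv (\<Prod>i\<in>I. [:- r i, 1:])) w = p * S"
    unfolding p_def S_def using insert by (intro poly_pderiv_prod_linear) auto
  have d2: "poly (pderiv (pderiv (\<Prod>i\<in>I. [:- r i, 1:]))) w = p * (S^2 - T)"
    unfolding p_def S_def T_def using insert by auto
  have "poly (pderiv (pderiv (\<Prod>i\<in>insert j I. [:- r i, 1:]))) w = (w - r j) * (p * (S^2 - T)) + 2 * (p * S)"
    using insert by (simp add: pderiv_linear_mult pderiv_add d1 d2 del: mult_pCons_left)
  also have "\<dots> = ((w - r j) * p) * (S^2 - T) + 2 * ((w - r j) * v) * p * S"
    by (simp add: v)
  also have "\<dots> = ((w - r j) * p) * ((v + S)^2 - (v^2 + T))"
    by (simp add: algebra_simps power2_eq_square)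
  finally show ?case using insert by (simp add: p_def v_def S_def T_def left_diff_distrib del: mult_pCons_left)
qed auto

lemma Re_inverse_one_minus_gt_half:
  assumes "cmod \<zeta> < 1"
  shows "Re (1 / (1 - \<zeta>)) > 1 / 2"
proof -
  define a b where "a = Re \<zeta>" and "b = Im \<zeta>"
  have ab: "a^2 + b^2 < 1"
    using assms by (simp add: a_def b_def cmod_power2[symmetric] power_less_one_iff)
  then have "a < 1"
    by (smt (verit) one_le_power zero_le_power2)
  then have D: "(1 - a)^2 + b^2 > 0" by (simp add: add_pos_nonneg)
  have "(1 - a)^2 + b^2 < 2 * (1 - a)" using ab by (simp add: power2_eq_square algebra_simps)
  then have "1 / 2 < (1 - a) / ((1 - a)^2 + b^2)" using D by (simp add: divide_simps)
  then show ?thesis by (simp add: Re_divide a_def b_def)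
qed

text \<open>The half plane \<open>|z| \<le> |z - n/2|\<close> is \<open>Re z \<le> n/4\<close>.\<close>

lemma admissible_U_nonzero:
  assumes "n \<ge> 1" and "admissible n l0 l1 l2" and "Re z > of_nat n / 4"
  shows "l0 + l1 * of_nat n * z + l2 * of_nat (n choose 2) * z^2 \<noteq> 0"
proof
  assume "l0 + l1 * of_nat n * z + l2 * of_nat (n choose 2) * z^2 = 0"
  then have "poly (U_poly n l0 l1 l2) z = 0"
    by (simp add: U_poly_def algebra_simps power2_eq_square)
  then have "cmod z \<le> cmod (z - of_nat n / 2)" using assms(2) by (simp add: admissible_def)
  then have "(cmod z)^2 \<le> (cmod (z - of_nat n / 2))^2" by (simp add: power_mono)
  then have "real n * Re z \<le> real n * (real n / 4)"
    unfolding cmod_power2 by (simp add: power2_eq_square algebra_simps)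
  then show False using assms(1,3) by simp
qed

text \<open>Fix \<open>w\<close> outside the open unit disc. In terms of \<open>x\<^sub>i = (n w / 2) / (w - r\<^sub>i)\<close>, with \<open>r\<^sub>i\<close> the zeros
  of \<open>f\<close>, the quotient \<open>B[f](w) / f(w)\<close> is the polarized form of \<open>U\<close>; and since
  \<open>x\<^sub>i = (n/2) / (1 - r\<^sub>i / w)\<close> with \<open>|r\<^sub>i / w| < 1\<close>, all \<open>x\<^sub>i\<close> lie in \<open>Re x > n/4\<close>.
  The degree must be exactly \<open>n\<close>, for otherwise there are fewer than \<open>n\<close> points.\<close>

lemma B_op_nonzero_outside:
  assumes adm: "admissible n l0 l1 l2" and n: "n \<ge> 1" and deg: "degree f = n"
    and roots: "\<And>z. poly f z = 0 \<Longrightarrow> cmod z < 1" and w: "cmod w \<ge> 1"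
  shows "poly (B_op n l0 l1 l2 f) w \<noteq> 0"
proof -
  obtain r where r: "smult (lead_coeff f) (\<Prod>i<degree f. [:- r i, 1:]) = f"
    using complex_poly_decompose' by blast
  define q where "q = (\<Prod>i<n. [:- r i, 1:])"
  define a where "a = lead_coeff f"
  have f: "f = smult a q" using r by (simp add: q_def a_def deg)
  have "f \<noteq> 0" using deg n by auto
  have w0: "w \<noteq> 0" using w by auto
  have ri: "cmod (r i) < 1" if "i < n" for i
  proof (rule roots)
    have "\<exists>j\<in>{..<n}. r i = r j" using that by auto
    then show "poly f (r i) = 0" by (simp add: f q_def poly_prod)
  qed
  have wr: "w \<noteq> r i" if "i < n" for i using ri[OF that] w by auto
  define v where "v i = 1 / (w - r i)" for i
  define x where "x i = of_nat n * w / 2 * v i" for i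
  have Re_x: "Re (x i) > real n / 4" if "i < n" for i
  proof -
    have "cmod (r i / w) < 1"
      using ri[OF that] w w0 by (simp add: norm_divide divide_simps)
    define y where "y = 1 / (1 - r i / w)"
    have "Re y > 1 / 2"
      unfolding y_def using \<open>cmod (r i / w) < 1\<close> by (rule Re_inverse_one_minus_gt_half)
    have "x i = of_real (real n / 2) * y"
      using w0 wr[OF that] by (simp add: x_def v_def y_def divide_simps)
    then have "Re (x i) = Re (of_real (real n / 2) * y)" by (rule arg_cong)
    also have "\<dots> = real n / 2 * Re y" unfolding times_complex.sel by simp
    finally have "Re (x i) = real n / 2 * Re y" .
    moreover have "real n / 2 * (1 / 2) < real n / 2 * Re y"
      using \<open>Re y > 1 / 2\<close> n by (intro mult_strict_left_mono) auto
    ultimately show ?thesis by simp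
  qed
  have nz: "l0 + l1 * (\<Sum>i<n. x i) + l2 * ((\<Sum>i<n. x i)^2 - (\<Sum>i<n. x i ^ 2)) / 2 \<noteq> 0"
    by (rule walsh_coincidence_quadratic[where c = "real n / 4", OF _ _ n _ admissible_U_nonzero[OF n adm]])
      (use Re_x in auto)
  have d1: "poly (pderiv q) w = poly q w * (\<Sum>i<n. v i)"
    unfolding q_def v_def using wr by (intro poly_pderiv_prod_linear) auto
  have d2: "poly (pderiv (pderiv q)) w = poly q w * ((\<Sum>i<n. v i)^2 - (\<Sum>i<n. v i ^ 2))"
    unfolding q_def v_def using wr by (intro poly_pderiv2_prod_linear) auto
  have sx: "(\<Sum>i<n. x i) = of_nat n * w / 2 * (\<Sum>i<n. v i)"
    by (simp add: x_def sum_distrib_left)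
  have sx2: "(\<Sum>i<n. x i ^ 2) = (of_nat n * w / 2)^2 * (\<Sum>i<n. v i ^ 2)"
    by (simp add: x_def sum_distrib_left power_mult_distrib power_divide)
  have "poly (B_op n l0 l1 l2 f) w = poly f w *
      (l0 + l1 * (\<Sum>i<n. x i) + l2 * ((\<Sum>i<n. x i)^2 - (\<Sum>i<n. x i ^ 2)) / 2)"
    unfolding poly_B_op sx sx2
    by (simp add: f pderiv_smult d1 d2 fact_2) (simp add: algebra_simps power2_eq_square)
  moreover have "poly f w \<noteq> 0" using roots[of w] w by auto
  ultimately show ?thesis using nz by simp
qed

section \<open>Zeros of \<open>B[F \<circ> \<sigma>] - \<alpha> B[F]\<close>\<close>

definition dilation_diff :: "real \<Rightarrow> complex \<Rightarrow> complex poly \<Rightarrow> complex poly" where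
  "dilation_diff R \<alpha> f = f \<circ>\<^sub>p [:0, of_real R:] - smult \<alpha> f"

lemma poly_dilation_diff:
  "poly (dilation_diff R \<alpha> f) z = poly f (of_real R * z) - \<alpha> * poly f z"
  by (simp add: dilation_diff_def poly_pcompose mult.commute)

lemma coeff_dilation_diff:
  "coeff (dilation_diff R \<alpha> f) k = (of_real R ^ k - \<alpha>) * coeff f k"
  by (simp add: dilation_diff_def coeff_pcompose_linear left_diff_distrib)

lemma degree_dilation_diff_le: "degree (dilation_diff R \<alpha> f) \<le> degree f"
  by (rule degree_le) (simp add: coeff_dilation_diff coeff_eq_0)

lemma norm_dilate_minus_gt:
  fixes a z :: complex
  assumes "cmod a \<le> 1" "cmod z \<ge> 1" "R > 1"
  shows "cmod (of_real R * z - a) > cmod (z - a)"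
proof -
  have "z \<bullet> a \<le> cmod z * cmod a" by (rule norm_cauchy_schwarz)
  also have "\<dots> \<le> cmod z * cmod z" using assms by (intro mult_left_mono) auto
  finally have za: "z \<bullet> a \<le> (cmod z)^2" by (simp add: power2_eq_square)
  have z1: "(cmod z)^2 \<ge> 1" using assms by (simp add: one_le_power)
  have "(cmod (of_real R * z - a))^2 - (cmod (z - a))^2 = (R - 1) * ((R - 1) * (cmod z)^2 + 2 * ((cmod z)^2 - z \<bullet> a))"
    by (simp add: cmod_power2 inner_complex_def) (simp add: power2_eq_square algebra_simps)
  also have "\<dots> > 0" using assms za z1 by (intro mult_pos_pos add_pos_nonneg) auto
  finally have "(cmod (z - a))^2 < (cmod (of_real R * z - a))^2" by simp
  then show ?thesis by (rule power_less_imp_less_base) simp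
qed

text \<open>Moving \<open>z\<close> radially away from the disc increases its distance to every zero.\<close>

lemma norm_poly_dilate_gt:
  assumes deg: "degree F \<ge> 1" and roots: "\<And>z. poly F z = 0 \<Longrightarrow> cmod z \<le> 1"
    and z: "cmod z \<ge> 1" and R: "R > 1"
  shows "cmod (poly F (of_real R * z)) > cmod (poly F z)"
proof -
  obtain r where r: "smult (lead_coeff F) (\<Prod>i<degree F. [:- r i, 1:]) = F"
    using complex_poly_decompose' by blast
  define a where "a = lead_coeff F"
  have pF: "poly F w = a * (\<Prod>i<degree F. w - r i)" for w
    by (subst r[symmetric]) (simp add: poly_prod a_def)
  have "a \<noteq> 0" using deg by (auto simp: a_def)
  have ri: "cmod (r i) \<le> 1" if "i < degree F" for i
    by (rule roots) (use that in \<open>auto simp: pF\<close>)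
  have lt: "cmod (z - r i) < cmod (of_real R * z - r i)" if "i < degree F" for i
    by (rule norm_dilate_minus_gt[OF ri[OF that] z R])
  have pos: "0 < cmod (of_real R * z - r i)" if "i < degree F" for i
    by (rule le_less_trans[OF norm_ge_zero lt[OF that]])
  have "(\<Prod>i<degree F. cmod (z - r i)) < (\<Prod>i<degree F. cmod (of_real R * z - r i))"
    using deg by (intro prod_mono_strict[of 0] conjI less_imp_le[OF lt] pos lt norm_ge_zero) auto
  then show ?thesis using \<open>a \<noteq> 0\<close> by (simp add: pF norm_mult prod_norm[symmetric])
qed

text \<open>By the strict growth of \<open>|F|\<close> under dilation, \<open>F(R z) - \<alpha> F(z)\<close> has its zeros in the \<^emph>\<open>open\<close> disc,
  even if \<open>F\<close> has zeros on the circle, and it keeps the degree \<open>n\<close> because \<open>R\<^sup>n \<noteq> \<alpha>\<close>.\<close>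

lemma B_op_dilation_diff_nonzero:
  assumes adm: "admissible n l0 l1 l2" and n: "n \<ge> 1" and deg: "degree F = n"
    and roots: "\<And>z. poly F z = 0 \<Longrightarrow> cmod z \<le> 1"
    and \<alpha>: "cmod \<alpha> \<le> 1" and R: "R > 1" and w: "cmod w \<ge> 1"
  shows "poly (B_op n l0 l1 l2 (dilation_diff R \<alpha> F)) w \<noteq> 0"
proof (rule B_op_nonzero_outside[OF adm n _ _ w])
  have "cmod \<alpha> < cmod (of_real R ^ n)"
    using \<alpha> R n by (intro le_less_trans[OF \<alpha>]) (simp add: norm_power one_less_power)
  then have "of_real R ^ n - \<alpha> \<noteq> 0" by auto
  moreover have "coeff F n \<noteq> 0" using deg n by auto
  ultimately have "degree (dilation_diff R \<alpha> F) \<ge> n"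
    by (intro le_degree) (simp add: coeff_dilation_diff)
  then show "degree (dilation_diff R \<alpha> F) = n"
    using degree_dilation_diff_le[of R \<alpha> F] deg by simp
next
  fix z assume z: "poly (dilation_diff R \<alpha> F) z = 0"
  show "cmod z < 1"
  proof (rule ccontr)
    assume "\<not> cmod z < 1"
    then have "cmod (poly F z) < cmod (poly F (of_real R * z))"
      using deg n roots R by (intro norm_poly_dilate_gt) auto
    also have "\<dots> = cmod \<alpha> * cmod (poly F z)"
      using z by (simp add: poly_dilation_diff norm_mult)
    also have "\<dots> \<le> cmod (poly F z)" using \<alpha> by (simp add: mult_left_le_one_le)
    finally show False by simp
  qed
qed

section \<open>The conjugate reciprocal polynomial\<close>

text \<open>This is \<open>z\<^sup>n\<close> times the conjugate of \<open>p(1 / cnj z)\<close>. The reversal is taken with respect to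
  the fixed \<open>n\<close> rather than to the degree of \<open>p\<close>, which makes it additive in \<open>p\<close>.\<close>

definition conj_reciprocal :: "nat \<Rightarrow> complex poly \<Rightarrow> complex poly" where
  "conj_reciprocal n p = (\<Sum>k\<le>n. monom (cnj (coeff p (n - k))) k)"

lemma coeff_conj_reciprocal:
  "coeff (conj_reciprocal n p) k = (if k \<le> n then cnj (coeff p (n - k)) else 0)"
  by (simp add: conj_reciprocal_def coeff_sum)

lemma degree_conj_reciprocal_le: "degree (conj_reciprocal n p) \<le> n"
  by (rule degree_le) (simp add: coeff_conj_reciprocal)

lemma conj_reciprocal_add_const:
  "conj_reciprocal n (p + [:c:]) = conj_reciprocal n p + monom (cnj c) n"
  by (rule poly_eqI) (auto simp: coeff_conj_reciprocal coeff_pCons split: nat.split)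

lemma poly_conj_reciprocal:
  assumes "degree p \<le> n" and "z \<noteq> 0"
  shows "poly (conj_reciprocal n p) z = z ^ n * cnj (poly p (1 / cnj z))"
proof -
  have "poly p x = (\<Sum>k\<le>n. coeff p k * x ^ k)" for x
    unfolding poly_altdef using assms(1)
    by (intro sum.mono_neutral_left) (auto simp: coeff_eq_0)
  then have "z ^ n * cnj (poly p (1 / cnj z)) = (\<Sum>k\<le>n. cnj (coeff p k) * z ^ (n - k))"
    using assms(2) by (simp add: sum_distrib_left power_diff power_one_over divide_simps mult_ac)
  also have "\<dots> = (\<Sum>k\<le>n. cnj (coeff p (n - k)) * z ^ k)"
    by (rule sum.reindex_bij_witness[of _ "\<lambda>k. n - k" "\<lambda>k. n - k"]) auto
  finally show ?thesis by (simp add: conj_reciprocal_def poly_sum poly_monom)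
qed

lemma norm_poly_conj_reciprocal:
  assumes "degree p \<le> n" and "z \<noteq> 0"
  shows "cmod (poly (conj_reciprocal n p) z) = cmod z ^ n * cmod (poly p (1 / cnj z))"
  using poly_conj_reciprocal[OF assms] by (simp add: norm_mult norm_power)

lemma conj_reciprocal_roots:
  assumes deg: "degree p \<le> n" and p: "\<And>z. cmod z < 1 \<Longrightarrow> poly p z \<noteq> 0"
  shows "degree (conj_reciprocal n p) = n"
    and "poly (conj_reciprocal n p) z = 0 \<Longrightarrow> cmod z \<le> 1"
proof -
  have "coeff p 0 \<noteq> 0" using p[of 0] by (simp add: poly_0_coeff_0)
  then have "n \<le> degree (conj_reciprocal n p)"
    by (intro le_degree) (simp add: coeff_conj_reciprocal)
  then show "degree (conj_reciprocal n p) = n"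
    using degree_conj_reciprocal_le[of n p] by simp
  assume z: "poly (conj_reciprocal n p) z = 0"
  show "cmod z \<le> 1"
  proof (rule ccontr)
    assume gt: "\<not> cmod z \<le> 1"
    then have "z \<noteq> 0" by auto
    then have "poly p (1 / cnj z) = 0" using z poly_conj_reciprocal[OF deg] by simp
    then show False using p[of "1 / cnj z"] gt by (simp add: norm_divide divide_simps)
  qed
qed

text \<open>For a zero \<open>r\<close> of \<open>p\<close>, so \<open>|r| \<ge> 1\<close>, each linear factor obeys
  \<open>|z - r| \<le> |1 - cnj z * r|\<close>, as the difference of the squares is
  \<open>(|z|\<^sup>2 - 1) (|r|\<^sup>2 - 1)\<close>. Arguing by factors rather than by the maximum
  principle for a quotient covers zeros on the circle as well.\<close>

lemma norm_le_conj_reciprocal_outside: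
  assumes deg: "degree p \<le> n" and p: "\<And>z. cmod z < 1 \<Longrightarrow> poly p z \<noteq> 0"
    and z: "cmod z \<ge> 1"
  shows "cmod (poly p z) \<le> cmod (poly (conj_reciprocal n p) z)"
proof -
  obtain r where r: "smult (lead_coeff p) (\<Prod>i<degree p. [:- r i, 1:]) = p"
    using complex_poly_decompose' by blast
  define a where "a = lead_coeff p"
  have pp: "poly p w = a * (\<Prod>i<degree p. w - r i)" for w
    by (subst r[symmetric]) (simp add: poly_prod a_def)
  have ri: "cmod (r i) \<ge> 1" if "i < degree p" for i
  proof -
    have "poly p (r i) = 0" using that by (auto simp: pp)
    then show ?thesis using p[of "r i"] by force
  qed
  have z0: "z \<noteq> 0" using z by auto
  have le: "cmod (z - r i) \<le> cmod z * cmod (1 / cnj z - r i)" if "i < degree p" for i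
  proof -
    have "((cmod z)^2 - 1) * ((cmod (r i))^2 - 1) \<ge> 0"
      using z ri[OF that] by (intro mult_nonneg_nonneg) (auto simp: one_le_power)
    moreover have "(cmod (1 - cnj z * r i))^2 - (cmod (z - r i))^2 = ((cmod z)^2 - 1) * ((cmod (r i))^2 - 1)"
      by (simp add: cmod_power2) (simp add: power2_eq_square algebra_simps)
    ultimately have "(cmod (z - r i))^2 \<le> (cmod (1 - cnj z * r i))^2" by linarith
    then have "cmod (z - r i) \<le> cmod (1 - cnj z * r i)" by (rule power2_le_imp_le) simp
    also have "1 - cnj z * r i = cnj z * (1 / cnj z - r i)" using z0 by (simp add: right_diff_distrib)
    finally show ?thesis by (simp add: norm_mult)
  qed
  have "(\<Prod>i<degree p. cmod (z - r i)) \<le> (\<Prod>i<degree p. cmod z * cmod (1 / cnj z - r i))"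
    using le by (intro prod_mono) auto
  also have "\<dots> = cmod z ^ degree p * (\<Prod>i<degree p. cmod (1 / cnj z - r i))"
    by (simp add: prod.distrib)
  also have "\<dots> \<le> cmod z ^ n * (\<Prod>i<degree p. cmod (1 / cnj z - r i))"
    using z deg by (intro mult_right_mono power_increasing prod_nonneg) auto
  finally have "cmod a * (\<Prod>i<degree p. cmod (z - r i)) \<le> cmod a * (cmod z ^ n * (\<Prod>i<degree p. cmod (1 / cnj z - r i)))"
    by (rule mult_left_mono) simp
  then show ?thesis
    by (simp add: norm_poly_conj_reciprocal[OF deg z0] pp norm_mult prod_norm[symmetric] mult_ac)
qed

text \<open>The coefficient of \<open>z\<^sup>n\<close> is, up to conjugation, the value of the reciprocal at \<open>0\<close>, that is, the
  limit of \<open>p(z) / z\<^sup>n\<close> at infinity.\<close>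

lemma norm_coeff_le_if_norm_le_outside:
  assumes "degree f \<le> n" "degree F \<le> n"
    and le: "\<And>z. cmod z \<ge> 1 \<Longrightarrow> cmod (poly f z) \<le> cmod (poly F z)"
  shows "cmod (coeff f n) \<le> cmod (coeff F n)"
proof -
  have at_0: "poly (conj_reciprocal n p) 0 = cnj (coeff p n)" for p
    by (simp add: poly_0_coeff_0 coeff_conj_reciprocal)
  have lim: "((\<lambda>z. cmod (poly (conj_reciprocal n p) z)) \<longlongrightarrow> cmod (coeff p n)) (at 0)" for p
  proof -
    have "isCont (\<lambda>z. cmod (poly (conj_reciprocal n p) z)) 0" by (intro continuous_intros)
    then show ?thesis by (simp add: isCont_def at_0)
  qed
  have "\<forall>\<^sub>F z in at (0::complex). z \<in> ball 0 1 - {0}"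
    by (rule eventually_at_in_open) auto
  then have "\<forall>\<^sub>F z in at 0. cmod (poly (conj_reciprocal n f) z) \<le> cmod (poly (conj_reciprocal n F) z)"
  proof (rule eventually_mono)
    fix z :: complex assume z: "z \<in> ball 0 1 - {0}"
    then have "cmod (1 / cnj z) \<ge> 1" by (simp add: norm_divide divide_simps)
    then show "cmod (poly (conj_reciprocal n f) z) \<le> cmod (poly (conj_reciprocal n F) z)"
      using z assms(1,2) by (simp add: norm_poly_conj_reciprocal le mult_left_mono)
  qed
  from tendsto_le[OF _ lim lim this] show ?thesis by simp
qed

section \<open>Comparison principle\<close>

lemma B_op_diff_smult:
  "B_op n l0 l1 l2 (p - smult c q) = B_op n l0 l1 l2 p - smult c (B_op n l0 l1 l2 q)"
  by (rule poly_eq_poly_eq_iff[THEN iffD1], rule ext)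
    (simp add: poly_B_op pderiv_diff pderiv_smult algebra_simps diff_divide_distrib)

lemma dilation_diff_add_smult:
  "dilation_diff R \<alpha> (p + smult c q) = dilation_diff R \<alpha> p + smult c (dilation_diff R \<alpha> q)"
  by (rule poly_eqI) (simp add: coeff_dilation_diff algebra_simps)

lemma poly_B_op_dilation_diff_add_smult:
  "poly (B_op n l0 l1 l2 (dilation_diff R \<alpha> (p + smult c q))) w
   = poly (B_op n l0 l1 l2 (dilation_diff R \<alpha> p)) w + c * poly (B_op n l0 l1 l2 (dilation_diff R \<alpha> q)) w"
  by (simp add: dilation_diff_add_smult poly_B_op pderiv_add pderiv_smult algebra_simps add_divide_distrib)

lemma poly_B_op_dilation_diff_one:
  "poly (B_op n l0 l1 l2 (dilation_diff R \<alpha> 1)) w = (1 - \<alpha>) * l0"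
proof -
  have "dilation_diff R \<alpha> 1 = [:1 - \<alpha>:]"
    by (rule poly_eqI) (auto simp: coeff_dilation_diff coeff_pCons split: nat.split)
  then show ?thesis by (simp add: poly_B_op)
qed

lemma poly_B_op_dilation_diff_power:
  assumes "n \<ge> 1"
  shows "poly (B_op n l0 l1 l2 (dilation_diff R \<alpha> (monom 1 n))) w
    = (of_real R ^ n - \<alpha>) * Lam n l0 l1 l2 * w ^ n"
proof -
  have d: "dilation_diff R \<alpha> (monom 1 n) = monom (of_real R ^ n - \<alpha>) n"
    by (rule poly_eqI) (auto simp: coeff_dilation_diff)
  show ?thesis
  proof (cases "n = 1")
    case True
    show ?thesis
      unfolding d unfolding True
      by (simp add: poly_B_op poly_monom pderiv_monom Lam_def fact_2) (simp add: algebra_simps)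
  next
    case False
    then obtain k where k: "n = Suc (Suc k)" using assms by (metis One_nat_def not_one_le_zero old.nat.exhaust)
    show ?thesis
      unfolding d
      by (simp add: poly_B_op poly_monom pderiv_monom Lam_def fact_2 k)
        (simp add: field_simps power2_eq_square power3_eq_cube)
  qed
qed

text \<open>Write \<open>T\<close> for the operator taking \<open>p\<close> to \<open>B[p \<circ> \<sigma>] - \<alpha> B[p]\<close>. If
  \<open>|T f(w)| > |T F(w)|\<close>, then some \<open>c\<close> with \<open>|c| < 1\<close> gives \<open>T (F + c f)(w) = 0\<close>. But
  \<open>F + c f\<close> is again of degree \<open>n\<close> with zeros in the closed disc, as \<open>|c f| < |F|\<close> for \<open>|z| > 1\<close>,
  so \<open>T (F + c f)\<close> has no zero \<open>w\<close> with \<open>|w| \<ge> 1\<close>.\<close>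

lemma norm_B_op_dilation_diff_le:
  assumes adm: "admissible n l0 l1 l2" and n: "n \<ge> 1"
    and f: "degree f \<le> n" and F: "degree F = n"
    and roots: "\<And>z. poly F z = 0 \<Longrightarrow> cmod z \<le> 1"
    and le: "\<And>z. cmod z \<ge> 1 \<Longrightarrow> cmod (poly f z) \<le> cmod (poly F z)"
    and \<alpha>: "cmod \<alpha> \<le> 1" and R: "R > 1" and w: "cmod w \<ge> 1"
  shows "cmod (poly (B_op n l0 l1 l2 (dilation_diff R \<alpha> f)) w)
    \<le> cmod (poly (B_op n l0 l1 l2 (dilation_diff R \<alpha> F)) w)"
proof (rule ccontr)
  define Tf TF where "Tf = poly (B_op n l0 l1 l2 (dilation_diff R \<alpha> f)) w"
    and "TF = poly (B_op n l0 l1 l2 (dilation_diff R \<alpha> F)) w"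
  assume "\<not> cmod (poly (B_op n l0 l1 l2 (dilation_diff R \<alpha> f)) w)
    \<le> cmod (poly (B_op n l0 l1 l2 (dilation_diff R \<alpha> F)) w)"
  then have lt: "cmod TF < cmod Tf" by (simp add: Tf_def TF_def)
  then have Tf0: "Tf \<noteq> 0" by auto
  define c where "c = - (TF / Tf)"
  have c: "cmod c < 1" using lt Tf0 by (simp add: c_def norm_divide divide_simps)
  have c_mult: "cmod (c * x) < cmod y" if "cmod x \<le> cmod y" "y \<noteq> 0" for x y
  proof -
    have "cmod c * cmod x \<le> cmod c * cmod y" using that by (intro mult_left_mono) auto
    also have "\<dots> < 1 * cmod y" using c that by (intro mult_strict_right_mono) auto
    finally show ?thesis by (simp add: norm_mult)
  qed
  define G where "G = F + smult c f"
  have "coeff F n \<noteq> 0" using F n by auto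
  then have "cmod (c * coeff f n) < cmod (coeff F n)"
    using norm_coeff_le_if_norm_le_outside[OF f _ le] F by (intro c_mult) auto
  then have "coeff G n \<noteq> 0" unfolding G_def using add_eq_0_iff[of "coeff F n" "c * coeff f n"] by auto
  then have "n \<le> degree G" by (rule le_degree)
  moreover have "degree G \<le> n"
    unfolding G_def using f F by (intro degree_add_le order_trans[OF degree_smult_le]) auto
  ultimately have degG: "degree G = n" by simp
  have rootsG: "cmod z \<le> 1" if "poly G z = 0" for z
  proof (rule ccontr)
    assume z: "\<not> cmod z \<le> 1"
    then have "poly F z \<noteq> 0" using roots by blast
    then have "cmod (c * poly f z) < cmod (poly F z)" using z by (intro c_mult le) auto
    moreover have "poly F z = - (c * poly f z)" using that by (simp add: G_def add_eq_0_iff2)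
    ultimately show False by simp
  qed
  have "poly (B_op n l0 l1 l2 (dilation_diff R \<alpha> G)) w \<noteq> 0"
    by (rule B_op_dilation_diff_nonzero[OF adm n degG rootsG \<alpha> R w])
  moreover have "poly (B_op n l0 l1 l2 (dilation_diff R \<alpha> G)) w = TF + c * Tf"
    by (simp add: G_def poly_B_op_dilation_diff_add_smult Tf_def TF_def)
  ultimately show False using Tf0 by (simp add: c_def)
qed

section \<open>Extremal values on the disc and the main inequality\<close>

lemma norm_poly_le_max_mod:
  assumes "cmod z \<le> 1"
  shows "cmod (poly p z) \<le> max_mod p"
proof (rule maximum_modulus_frontier[where S = "cball 0 1" and f = "poly p"])
  fix z :: complex assume "z \<in> frontier (cball 0 1)"
  then have "z \<in> sphere 0 1" by simp
  then show "cmod (poly p z) \<le> max_mod p" using max_mod_attained[of p] by auto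
qed (use assms in \<open>auto intro!: holomorphic_intros continuous_intros\<close>)

text \<open>The minimum modulus principle, from the maximum principle for \<open>1 / p\<close>.\<close>

lemma min_mod_le_norm_poly:
  assumes nz: "\<And>z. cmod z < 1 \<Longrightarrow> poly p z \<noteq> 0" and z: "cmod z \<le> 1"
  shows "min_mod p \<le> cmod (poly p z)"
proof (cases "min_mod p > 0")
  case True
  have bd: "min_mod p \<le> cmod (poly p x)" if "cmod x = 1" for x
    using min_mod_attained[of p] that by auto
  have nz': "poly p x \<noteq> 0" if "cmod x \<le> 1" for x
    using nz[of x] bd[of x] True that by (cases "cmod x = 1") auto
  have "cmod (1 / poly p z) \<le> 1 / min_mod p"
  proof (rule maximum_modulus_frontier[where S = "cball 0 1" and f = "\<lambda>x. 1 / poly p x"])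
    fix x :: complex assume "x \<in> frontier (cball 0 1)"
    then have "cmod x = 1" by simp
    then show "cmod (1 / poly p x) \<le> 1 / min_mod p"
      using bd[of x] True by (simp add: norm_divide frac_le)
  qed (use z nz' in \<open>auto intro!: holomorphic_intros continuous_intros\<close>)
  then show ?thesis using True nz'[OF z] by (simp add: norm_divide divide_simps)
next
  case False
  then show ?thesis using norm_ge_zero[of "poly p z"] by linarith
qed

text \<open>Rotating \<open>y\<close> into the direction of \<open>x\<close> turns the reverse triangle inequality into an equality, with one
  rotation for all scalings.\<close>

lemma unimodular_aligning:
  fixes x y :: complex
  obtains u where "cmod u = 1"
    and "\<And>t. cmod (x - of_real t * (u * y)) = \<bar>cmod x - t * cmod y\<bar>"
proof (cases "x = 0 \<or> y = 0")
  case True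
  then show ?thesis using that[of 1] by (auto simp: norm_mult abs_mult)
next
  case False
  define u where "u = (x / of_real (cmod x)) / (y / of_real (cmod y))"
  have "cmod u = 1" using False by (simp add: u_def norm_divide norm_mult)
  moreover have "cmod (x - of_real t * (u * y)) = \<bar>cmod x - t * cmod y\<bar>" for t
  proof -
    have "x - of_real t * (u * y) = (x / of_real (cmod x)) * of_real (cmod x - t * cmod y)"
      using False by (simp add: u_def field_simps)
    then have "cmod (x - of_real t * (u * y)) = cmod (x / of_real (cmod x)) * \<bar>cmod x - t * cmod y\<bar>"
      by (simp only: norm_mult norm_of_real)
    then show ?thesis using False by (simp add: norm_divide)
  qed
  ultimately show ?thesis using that by blast
qed

text \<open>The comparison principle for \<open>P + c\<close> and its reciprocal \<open>Q + cnj c * z\<^sup>n\<close>, where \<open>Q\<close> is the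
  reciprocal of \<open>P\<close>.\<close>

lemma B_op_dilation_diff_shift_le:
  assumes adm: "admissible n l0 l1 l2" and n: "n \<ge> 1" and P: "degree P \<le> n"
    and nz: "\<And>z. cmod z < 1 \<Longrightarrow> poly P z + c \<noteq> 0"
    and \<alpha>: "cmod \<alpha> \<le> 1" and R: "R > 1" and w: "cmod w \<ge> 1"
  shows "cmod (poly (B_op n l0 l1 l2 (dilation_diff R \<alpha> P)) w + c * ((1 - \<alpha>) * l0))
    \<le> cmod (poly (B_op n l0 l1 l2 (dilation_diff R \<alpha> (conj_reciprocal n P))) w
        + cnj c * ((of_real R ^ n - \<alpha>) * Lam n l0 l1 l2 * w ^ n))"
proof -
  define h where "h = P + smult c 1"
  have deg: "degree h \<le> n" unfolding h_def using P by (intro degree_add_le) auto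
  have h: "poly h z \<noteq> 0" if "cmod z < 1" for z using nz[OF that] by (simp add: h_def)
  have rec: "conj_reciprocal n h = conj_reciprocal n P + smult (cnj c) (monom 1 n)"
    using conj_reciprocal_add_const[of n P c] by (simp add: h_def smult_monom smult_one)
  have "cmod (poly (B_op n l0 l1 l2 (dilation_diff R \<alpha> h)) w)
    \<le> cmod (poly (B_op n l0 l1 l2 (dilation_diff R \<alpha> (conj_reciprocal n h))) w)"
    using conj_reciprocal_roots[OF deg h] norm_le_conj_reciprocal_outside[OF deg h]
    by (intro norm_B_op_dilation_diff_le[OF adm n deg _ _ _ \<alpha> R w]) auto
  then show ?thesis
    unfolding rec
    unfolding h_def poly_B_op_dilation_diff_add_smult
    by (simp add: poly_B_op_dilation_diff_one poly_B_op_dilation_diff_power[OF n])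
qed

theorem corollary5:
  fixes n :: nat and P :: "complex poly" and B :: "complex poly \<Rightarrow> complex poly"
    and l0 l1 l2 \<alpha> :: complex and R :: real
  assumes "n \<ge> 1"
    and "degree P \<le> n"
    and "\<And>z. cmod z < 1 \<Longrightarrow> poly P z \<noteq> 0"
    and "B_class n l0 l1 l2 B"
    and "cmod \<alpha> \<le> 1"
    and "R > 1"
  shows "max_mod (B (P \<circ>\<^sub>p [:0, of_real R:]) - smult \<alpha> (B P))
    \<le> (cmod (of_real R ^ n - \<alpha>) * cmod (Lam n l0 l1 l2) + cmod ((1 - \<alpha>) * l0)) / 2 * max_mod P
      - (cmod (of_real R ^ n - \<alpha>) * cmod (Lam n l0 l1 l2) - cmod ((1 - \<alpha>) * l0)) / 2 * min_mod P"
proof -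
  define T where "T p = B_op n l0 l1 l2 (dilation_diff R \<alpha> p)" for p
  define M m Q where "M = max_mod P" and "m = min_mod P" and "Q = conj_reciprocal n P"
  define a b where "a = (1 - \<alpha>) * l0" and "b = (of_real R ^ n - \<alpha>) * Lam n l0 l1 l2"
  note n = assms(1) and deg = assms(2) and nz = assms(3) and \<alpha> = assms(5) and R = assms(6)
  have adm: "admissible n l0 l1 l2" using assms(4) by (simp add: B_class_def)
  have TP: "B (P \<circ>\<^sub>p [:0, of_real R:]) - smult \<alpha> (B P) = T P"
  proof -
    have "degree (P \<circ>\<^sub>p [:0, of_real R:]) \<le> n" using deg by (simp add: degree_pcompose)
    then show ?thesis
      using assms(4) deg by (simp add: B_class_def T_def dilation_diff_def B_op_diff_smult)
  qed
  have PM: "cmod (poly P z) \<le> M" if "cmod z \<le> 1" for z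
    unfolding M_def by (rule norm_poly_le_max_mod[OF that])
  have Pm: "m \<le> cmod (poly P z)" if "cmod z \<le> 1" for z
    unfolding m_def by (rule min_mod_le_norm_poly[OF nz that])
  have m0: "m \<ge> 0" using min_mod_attained[of P] by (auto simp: m_def)
  have M0: "M > 0"
    using PM[of 0] nz[of 0] by (smt (verit) norm_zero zero_less_norm_iff)
  obtain w where w: "cmod w = 1" and max_w: "max_mod (T P) = cmod (poly (T P) w)"
    using max_mod_attained[of "T P"] by auto
  define p q where "p = cmod (poly (T P) w)" and "q = cmod (poly (T Q) w)"
  have Tpow: "poly (T (smult c (monom 1 n))) w = c * b * w ^ n" for c
  proof -
    have "poly (T 0) w = 0" by (simp add: T_def dilation_diff_def B_op_def)
    then show ?thesis
      using poly_B_op_dilation_diff_add_smult[of n l0 l1 l2 R \<alpha> 0 c "monom 1 n" w]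
      by (simp add: b_def poly_B_op_dilation_diff_power[OF n] T_def[symmetric] del: smult_monom)
        (simp add: T_def poly_B_op_dilation_diff_power[OF n])
  qed
  have shift: "cmod (poly (T P) w + c * a) \<le> cmod (poly (T Q) w + cnj c * (b * w ^ n))"
    if "\<And>z. cmod z < 1 \<Longrightarrow> poly P z + c \<noteq> 0" for c
    using B_op_dilation_diff_shift_le[OF adm n deg that \<alpha> R, of w] w by (simp add: T_def Q_def a_def b_def)
  have norm_Q: "cmod (poly Q z) = cmod z ^ n * cmod (poly P (1 / cnj z))" "cmod (1 / cnj z) \<le> 1"
    if "cmod z \<ge> 1" for z
    using that norm_poly_conj_reciprocal[OF deg, of z] unfolding Q_def
    by (force simp: norm_divide divide_simps)+
  \<comment> \<open>The comparison principle for \<open>m z\<^sup>n\<close> and \<open>Q\<close>: \<open>|P| \<ge> m\<close> inside the disc means \<open>|Q| \<ge> m |z|\<^sup>n\<close> outside.\<close>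
  have q_lower: "m * cmod b \<le> q"
  proof -
    have "cmod (poly (T (smult (of_real m) (monom 1 n))) w) \<le> q"
      unfolding q_def T_def
    proof (rule norm_B_op_dilation_diff_le[OF adm n _ _ _ _ \<alpha> R])
      fix z :: complex assume z: "cmod z \<ge> 1"
      have "cmod z ^ n * m \<le> cmod z ^ n * cmod (poly P (1 / cnj z))"
        using z norm_Q(2)[OF z] by (intro mult_left_mono Pm) auto
      then show "cmod (poly (smult (of_real m) (monom 1 n)) z) \<le> cmod (poly Q z)"
        using m0 norm_Q(1)[OF z] by (simp add: poly_monom norm_mult norm_power mult.commute)
    qed (use conj_reciprocal_roots[OF deg nz] w in
        \<open>auto simp: Q_def intro: order_trans[OF degree_smult_le] degree_monom_le\<close>)
    then show ?thesis unfolding Tpow using m0 w by (simp add: norm_mult norm_power)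
  qed
  \<comment> \<open>Likewise for \<open>Q\<close> and \<open>M z\<^sup>n\<close>, from \<open>|P| \<le> M\<close> inside the disc.\<close>
  have q_upper: "q \<le> M * cmod b"
  proof -
    have "q \<le> cmod (poly (T (smult (of_real M) (monom 1 n))) w)"
      unfolding q_def T_def
    proof (rule norm_B_op_dilation_diff_le[OF adm n _ _ _ _ \<alpha> R])
      fix z :: complex assume z: "cmod z \<ge> 1"
      have "cmod z ^ n * cmod (poly P (1 / cnj z)) \<le> cmod z ^ n * M"
        using z norm_Q(2)[OF z] by (intro mult_left_mono PM) auto
      then show "cmod (poly Q z) \<le> cmod (poly (smult (of_real M) (monom 1 n)) z)"
        using M0 norm_Q(1)[OF z] by (simp add: poly_monom norm_mult norm_power mult.commute)
    qed (use M0 n w degree_conj_reciprocal_le in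
        \<open>auto simp: Q_def poly_monom degree_monom_eq\<close>)
    then show ?thesis unfolding Tpow using M0 w by (simp add: norm_mult norm_power)
  qed
  obtain u where u: "cmod u = 1"
    and align: "\<And>t. cmod (poly (T Q) w - of_real t * (u * (b * w ^ n))) = \<bar>q - t * cmod b\<bar>"
    using unimodular_aligning[of "poly (T Q) w" "b * w ^ n"] w
    by (auto simp: q_def norm_mult norm_power)
  \<comment> \<open>The shift is free in its argument; it is chosen so that the two terms on the right-hand side align.\<close>
  have rotated: "p - s * cmod a \<le> \<bar>q - s * cmod b\<bar>"
    if s: "0 \<le> s" and avoid: "\<And>z. cmod z < 1 \<Longrightarrow> cmod (poly P z) \<noteq> s" for s
  proof -
    define c where "c = - (of_real s * cnj u)"
    have c: "cmod c = s" using s u by (simp add: c_def norm_mult)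
    have "poly P z + c \<noteq> 0" if "cmod z < 1" for z
      using avoid[OF that] c by (metis add_eq_0_iff2 norm_minus_cancel)
    then have "cmod (poly (T P) w + c * a) \<le> cmod (poly (T Q) w + cnj c * (b * w ^ n))"
      by (rule shift)
    also have "\<dots> = \<bar>q - s * cmod b\<bar>"
      using align[of s] by (simp add: c_def mult.assoc)
    finally show ?thesis
      using norm_diff_ineq[of "poly (T P) w" "c * a"] by (simp add: p_def norm_mult c)
  qed
  \<comment> \<open>Shifts of modulus \<open>t m\<close> with \<open>t < 1\<close> are harmless because \<open>|P| \<ge> m\<close>; then \<open>t\<close> tends to 1.\<close>
  have lower: "m * (cmod b - cmod a) \<le> q - p"
  proof (rule field_le_mult_one_interval)
    fix t :: real assume t: "0 < t" "t < 1"
    have "cmod (poly P z) \<noteq> t * m" if z: "cmod z < 1" for z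
    proof
      assume eq: "cmod (poly P z) = t * m"
      then have "m * (1 - t) \<le> 0" using Pm[of z] z by (simp add: algebra_simps)
      then have "m = 0" using m0 t by (simp add: mult_le_0_iff)
      then show False using eq nz[OF z] by simp
    qed
    then have "p - t * m * cmod a \<le> \<bar>q - t * m * cmod b\<bar>" using t m0 by (intro rotated) auto
    moreover have "t * (m * cmod b) \<le> m * cmod b" using t m0 by (intro mult_left_le_one_le) auto
    ultimately show "t * (m * (cmod b - cmod a)) \<le> q - p"
      using q_lower by (simp add: algebra_simps)
  qed
  \<comment> \<open>Shifts of modulus \<open>t M\<close> with \<open>t > 1\<close> are harmless because \<open>|P| \<le> M\<close>; now \<open>q_upper\<close> reverses the sign inside the absolute value.\<close>
  have upper: "p + q \<le> M * (cmod a + cmod b)"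
  proof (rule field_le_mult_one_interval)
    fix s :: real assume s: "0 < s" "s < 1"
    define t where "t = 1 / s"
    have t: "t > 1" using s by (simp add: t_def)
    have "M < t * M" using t M0 by simp
    then have "p - t * M * cmod a \<le> \<bar>q - t * M * cmod b\<bar>"
      using t M0 PM by (intro rotated) (force intro: less_imp_le)+
    moreover have "M * cmod b \<le> t * M * cmod b"
      using \<open>M < t * M\<close> by (intro mult_right_mono) auto
    ultimately have "p + q \<le> t * (M * (cmod a + cmod b))"
      using q_upper by (simp add: algebra_simps)
    then show "s * (p + q) \<le> M * (cmod a + cmod b)"
      using s by (simp add: t_def field_simps)
  qed
  have "2 * p \<le> (cmod b + cmod a) * M - (cmod b - cmod a) * m"
    using lower upper by (simp add: algebra_simps)
  then show ?thesis
    unfolding TP max_w p_def[symmetric] M_def[symmetric] m_def[symmetric]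
      norm_mult[of "of_real R ^ n - \<alpha>", symmetric] a_def[symmetric] b_def[symmetric]
    by (simp add: field_simps)
qed

end
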